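(* In $\tilde{\mathcal A}_q^{\{\delta\}}$ the following relations hold for every $k\in\mathbb Z_+$: $$\mathcal G_{k+1} = -\sum_{l=0}^{[\frac{k}{2}]}\ \sum_{i+j=2l+1-\bar k} \frac{f^{(k)}_{ij}}{2}\,\mathbb W_{ij} \;-\; \sum_{l=0}^{[\frac{k}{2}]-\bar k}\ \sum_{i+j=2l+\bar k} \frac{e^{(k)}_{ij}}{2}\,\mathbb F_{ij} \;-\; \sum_{l=0}^{[\frac{k}{2}]-1}\frac{d^{(k)}_{l}}{2}\,\mathbb G_{2(l+1)-\bar k} \;+\; \frac{q+q^{-1}}{2}\big[\mathcal W_{k+1},\mathcal W_0\big] + \delta_{k+1}$$ and $$\mathcal W_{-k-1}=\frac{1}{\rho}\big[\mathcal W_0,\mathcal G_{k+1}\big]_q+\mathcal W_{k+1}.$$ The expressions for the other generators are given by $\mathcal W_{k+1}=\Omega(\mathcal W_{-k})$ and $\tilde{\mathcal G}_{k+1}=\Omega(\mathcal G_{k+1})$.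
   Context: Conventions. $\mathbb K$ is a field of characteristic different from $2$, $q\in\mathbb K$ is nonzero and not a root of unity, $\rho\in\mathbb K$ is nonzero, $\mathbb Z_+$ is the set of nonnegative integers, $[X,Y]=XY-YX$, $[X,Y]_q=qXY-q^{-1}YX$. All summation indices $i,j,l,m$ range in $\mathbb Z_+$; empty sums are zero. The algebra $\mathcal A_q$. It is the unital associative $\mathbb K$-algebra with generators $\{\mathcal W_{-k},\mathcal W_{k+1},\mathcal G_{k+1},\tilde{\mathcal G}_{k+1}\mid k\in\mathbb Z_+\}$ and the following relations. Put $U=(qu^2+q^{-1}u^{-2})/(q+q^{-1})$, $V=(qv^2+q^{-1}v^{-2})/(q+q^{-1})$ with $u,v$ indeterminates, and $$\mathcal W_+(u)=\sum_{k\ge0}\mathcal W_{-k}U^{-k-1},\quad \mathcal W_-(u)=\sum_{k\ge0}\mathcal W_{k+1}U^{-k-1},\quad \mathcal G_+(u)=\sum_{k\ge0}\mathcal G_{k+1}U^{-k-1},\quad \mathcal G_-(u)=\sum_{k\ge0}\tilde{\mathcal G}_{k+1}U^{-k-1}$$ (and the same with $v,V$). The relations (identities of formal series in $U,V$; each holds for the upper and for the lower choice of signs, and fractions with denominator $U-V$ are understood after multiplying by $U-V$) are: (1) $[\mathcal W_\pm(u),\mathcal W_\pm(v)]=0$; (2) $[\mathcal W_+(u),\mathcal W_-(v)]+[\mathcal W_-(u),\mathcal W_+(v)]=0$; (3) $(U-V)[\mathcal W_\pm(u),\mathcal W_\mp(v)]=\frac{q-q^{-1}}{\rho(q+q^{-1})}\big(\mathcal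 G_\pm(u)\mathcal G_\mp(v)-\mathcal G_\pm(v)\mathcal G_\mp(u)\big)+\frac{1}{q+q^{-1}}\big(\mathcal G_\pm(u)-\mathcal G_\mp(u)+\mathcal G_\mp(v)-\mathcal G_\pm(v)\big)$; (4) $\mathcal W_\pm(u)\mathcal W_\pm(v)-\mathcal W_\mp(u)\mathcal W_\mp(v)+\frac{1}{\rho(q^2-q^{-2})}[\mathcal G_\pm(u),\mathcal G_\mp(v)]+\frac{1-UV}{U-V}\big(\mathcal W_\pm(u)\mathcal W_\mp(v)-\mathcal W_\pm(v)\mathcal W_\mp(u)\big)=0$; (5) $U[\mathcal G_\mp(v),\mathcal W_\pm(u)]_q-V[\mathcal G_\mp(u),\mathcal W_\pm(v)]_q-(q-q^{-1})\big(\mathcal W_\mp(u)\mathcal G_\mp(v)-\mathcal W_\mp(v)\mathcal G_\mp(u)\big)+\rho\big(U\mathcal W_\pm(u)-V\mathcal W_\pm(v)-\mathcal W_\mp(u)+\mathcal W_\mp(v)\big)=0$; (6) $U[\mathcal W_\mp(u),\mathcal G_\mp(v)]_q-V[\mathcal W_\mp(v),\mathcal G_\mp(u)]_q-(q-q^{-1})\big(\mathcal W_\pm(u)\mathcal G_\mp(v)-\mathcal W_\pm(v)\mathcal G_\mp(u)\big)+\rho\big(U\mathcal W_\mp(u)-V\mathcal W_\mp(v)-\mathcal W_\pm(u)+\mathcal W_\pm(v)\big)=0$; (7) $[\mathcal G_\epsilon(u),\mathcal W_\pm(v)]+[\mathcal W_\pm(u),\mathcal G_\epsilon(v)]=0$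 for $\epsilon=\pm$; (8) $[\mathcal G_\pm(u),\mathcal G_\pm(v)]=0$; (9) $[\mathcal G_+(u),\mathcal G_-(v)]+[\mathcal G_-(u),\mathcal G_+(v)]=0$. The elements $\Delta_{k+1}$. For $k\in\mathbb Z_+$ let $\bar k=1$ and $[\frac k2]=\frac k2$ if $k$ is even, $\bar k=0$ and $[\frac k2]=\frac{k-1}2$ if $k$ is odd. Put $\mathbb G_{i+1}=\mathcal G_{i+1}+\tilde{\mathcal G}_{i+1}$, $\mathbb W_{ij}=(q-q^{-1})(\mathcal W_{-i}\mathcal W_{j+1}+\mathcal W_{i+1}\mathcal W_{-j})$, $\mathbb F_{ij}=(q-q^{-1})\big((q^2+q^{-2})(\mathcal W_{-i}\mathcal W_{-j}+\mathcal W_{i+1}\mathcal W_{j+1})+\frac1\rho(\mathcal G_{j+1}\tilde{\mathcal G}_{i+1}+\tilde{\mathcal G}_{j+1}\mathcal G_{i+1})\big)$, $c_{k+1}=-\frac{(q+q^{-1})^{k+1}(q^{k+1}+q^{-k-1})}{q^{2k+2}}$, $w^i_m=(-1)^m\frac{(m+i)!}{m!\,i!}(q+q^{-1})^{i+1}q^{-i-2m-1}$ for $m\ge0$, $w^i_{-1}=0$, $e^{(k)}_{ij}=-c_{k+1}^{-1}\sum_{m=0}^{[\frac k2]-\frac{i+j+\bar k}2}w^i_{[\frac k2]-\frac{i+j+\bar k}2-m}\,w^j_m\,q^{-2j-4m-2}$, $f^{(k)}_{ij}=c_{k+1}^{-1}\sum_{m=0}^{[\frac k2]-\frac{i+j+\bar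 k-1}2}w^i_{[\frac k2]-\frac{i+j+\bar k-1}2-m}\,(w^j_m+w^j_{m-1})\,q^{-2j-4m}$, $d^{(k)}_l=-c_{k+1}^{-1}w^{2l+1-\bar k}_{[\frac k2]-l}(1+q^{-2k-2})$, $$\Delta_{k+1}=\mathbb G_{k+1}+\sum_{l=0}^{[\frac k2]-1}d^{(k)}_l\mathbb G_{2(l+1)-\bar k}+\sum_{l=0}^{[\frac k2]}\sum_{i+j=2l+1-\bar k}f^{(k)}_{ij}\mathbb W_{ij}+\sum_{l=0}^{[\frac k2]-\bar k}\sum_{i+j=2l+\bar k}e^{(k)}_{ij}\mathbb F_{ij}.$$ The quotient. Let $\delta_{k+1}\in\mathbb K$ ($k\in\mathbb Z_+$) be fixed scalars. $\tilde{\mathcal A}_q^{\{\delta\}}$ is the quotient of $\mathcal A_q$ by the ideal generated by the relations $\Delta_{k+1}=2\delta_{k+1}$ for all $k\in\mathbb Z_+$. Generators of $\mathcal A_q$ and their images in the quotient are denoted by the same symbols. The automorphism $\Omega$. $\mathcal A_q$ has an automorphism $\Omega$ with $\Omega(\mathcal W_{-k})=\mathcal W_{k+1}$, $\Omega(\mathcal W_{k+1})=\mathcal W_{-k}$, $\Omega(\mathcal G_{k+1})=\tilde{\mathcal G}_{k+1}$, $\Omega(\tilde{\mathcal G}_{k+1})=\mathcal G_{k+1}$; it fixes every $\Delta_{k+1}$ and hence induces an automorphism of $\tilde{\mathcal A}_q^{\{\delta\}}$, also denoted $\Omega$. *)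

theory Defs
  imports
    "HOL-Library.Poly_Mapping"
    "HOL-Computational_Algebra.Formal_Laurent_Series"
    "HOL-Algebra.Algebraic_Closure_Type"
begin

section \<open>The free algebra\<close>

text \<open>
  The constructors are indexed as in the list of generators:
  \<open>GWm k\<close> is $W_{-k}$, \<open>GWp k\<close> is $W_{k+1}$, \<open>GG k\<close> is $G_{k+1}$,
  and \<open>GGt k\<close> is $\tilde G_{k+1}$.
\<close>

datatype gen = GWm nat | GWp nat | GG nat | GGt nat

datatype word = Word (letters: "gen list")

instantiation word :: monoid_add
begin
definition zero_word :: word where "0 = Word []"
definition plus_word :: "word \<Rightarrow> word \<Rightarrow> word" where "v + w = Word (letters v @ letters w)"
instance by standard (simp_all add: zero_word_def plus_word_def)
end

text \<open>
  The free monoid is written additively, so that the convolution product of \<open>Poly_Mapping\<close>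
  makes the finitely supported functions on words the free unital associative algebra.
\<close>

type_synonym 'k free_alg = "word \<Rightarrow>\<^sub>0 'k"

definition sc :: "'k::field \<Rightarrow> 'k free_alg" where
  "sc c = Poly_Mapping.single 0 c"

definition gen_elem :: "gen \<Rightarrow> 'k::field free_alg" where
  "gen_elem g = Poly_Mapping.single (Word [g]) 1"

abbreviation Wm :: "nat \<Rightarrow> 'k::field free_alg" where "Wm k \<equiv> gen_elem (GWm k)"
abbreviation Wp :: "nat \<Rightarrow> 'k::field free_alg" where "Wp k \<equiv> gen_elem (GWp k)"
abbreviation G :: "nat \<Rightarrow> 'k::field free_alg" where "G k \<equiv> gen_elem (GG k)"
abbreviation Gt :: "nat \<Rightarrow> 'k::field free_alg" where "Gt k \<equiv> gen_elem (GGt k)"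

definition comm :: "'a::ring_1 \<Rightarrow> 'a \<Rightarrow> 'a" where
  "comm x y = x * y - y * x"

definition qcomm :: "'k::field \<Rightarrow> 'k free_alg \<Rightarrow> 'k free_alg \<Rightarrow> 'k free_alg" where
  "qcomm q x y = sc q * x * y - sc (inverse q) * y * x"


section \<open>Generating series and the defining relations\<close>

text \<open>
  Series in $U^{-1}, V^{-1}$ with finitely many positive powers: the inner Laurent variable is
  $U^{-1}$ and the outer one is $V^{-1}$.
\<close>

type_synonym 'k series = "'k free_alg fls fls"

definition cst :: "'k::field \<Rightarrow> 'k series" where
  "cst c = fls_const (fls_const (sc c))"

definition U :: "'k::field series" where "U = fls_const fls_X_inv"
definition V :: "'k::field series" where "V = fls_X_inv"

definition gser :: "(nat \<Rightarrow> 'a::ring_1) \<Rightarrow> 'a fls" where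
  "gser a = fls_X * fps_to_fls (Abs_fps a)"

datatype sign = Plus | Minus

fun opp :: "sign \<Rightarrow> sign" where
  "opp Plus = Minus"
| "opp Minus = Plus"

fun Wgen :: "sign \<Rightarrow> nat \<Rightarrow> 'k::field free_alg" where
  "Wgen Plus k = Wm k"
| "Wgen Minus k = Wp k"

fun Ggen :: "sign \<Rightarrow> nat \<Rightarrow> 'k::field free_alg" where
  "Ggen Plus k = G k"
| "Ggen Minus k = Gt k"

definition Wu :: "sign \<Rightarrow> 'k::field series" where "Wu s = fls_const (gser (Wgen s))"
definition Wv :: "sign \<Rightarrow> 'k::field series" where "Wv s = gser (\<lambda>k. fls_const (Wgen s k))"
definition Gu :: "sign \<Rightarrow> 'k::field series" where "Gu s = fls_const (gser (Ggen s))"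
definition Gv :: "sign \<Rightarrow> 'k::field series" where "Gv s = gser (\<lambda>k. fls_const (Ggen s k))"

definition qcomm_ser :: "'k::field \<Rightarrow> 'k series \<Rightarrow> 'k series \<Rightarrow> 'k series" where
  "qcomm_ser q x y = cst q * x * y - cst (inverse q) * y * x"

text \<open>
  The series that are required to vanish, for the choice \<open>s\<close> of the upper sign.  The third and
  the fourth relation are multiplied by $U - V$.
\<close>

definition relation_series :: "'k::field \<Rightarrow> 'k \<Rightarrow> sign \<Rightarrow> 'k series set" where
  "relation_series q \<rho> s = (let t = opp s in
    { comm (Wu s) (Wv s),
      comm (Wu Plus) (Wv Minus) + comm (Wu Minus) (Wv Plus),
      (U - V) * comm (Wu s) (Wv t)
        - (cst ((q - inverse q) / (\<rho> * (q + inverse q))) * (Gu s * Gv t - Gv s * Gu t)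
           + cst (1 / (q + inverse q)) * (Gu s - Gu t + Gv t - Gv s)),
      (U - V) * (Wu s * Wv s - Wu t * Wv t
                 + cst (1 / (\<rho> * (q\<^sup>2 - inverse q ^ 2))) * comm (Gu s) (Gv t))
        + (1 - U * V) * (Wu s * Wv t - Wv s * Wu t),
      U * qcomm_ser q (Gv t) (Wu s) - V * qcomm_ser q (Gu t) (Wv s)
        - cst (q - inverse q) * (Wu t * Gv t - Wv t * Gu t)
        + cst \<rho> * (U * Wu s - V * Wv s - Wu t + Wv t),
      U * qcomm_ser q (Wu t) (Gv t) - V * qcomm_ser q (Wv t) (Gu t)
        - cst (q - inverse q) * (Wu s * Gv t - Wv s * Gu t)
        + cst \<rho> * (U * Wu t - V * Wv t - Wu s + Wv s),
      comm (Gu Plus) (Wv s) + comm (Wu s) (Gv Plus),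
      comm (Gu Minus) (Wv s) + comm (Wu s) (Gv Minus),
      comm (Gu s) (Gv s),
      comm (Gu Plus) (Gv Minus) + comm (Gu Minus) (Gv Plus) })"

definition relators :: "'k::field \<Rightarrow> 'k \<Rightarrow> 'k free_alg set" where
  "relators q \<rho> = {fls_nth (fls_nth S b) a | S a b. \<exists>s. S \<in> relation_series q \<rho> s}"

definition Aq_ideal :: "'k::field \<Rightarrow> 'k \<Rightarrow> 'k free_alg set" where
  "Aq_ideal q \<rho> = Idl\<^bsub>ring_of_type_algebra\<^esub> (relators q \<rho>)"

definition Aq :: "'k::field \<Rightarrow> 'k \<Rightarrow> 'k free_alg set ring" where
  "Aq q \<rho> = ring_of_type_algebra Quot (Aq_ideal q \<rho>)"

definition toAq :: "'k::field \<Rightarrow> 'k \<Rightarrow> 'k free_alg \<Rightarrow> 'k free_alg set" where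
  "toAq q \<rho> x = Aq_ideal q \<rho> +>\<^bsub>ring_of_type_algebra\<^esub> x"


section \<open>The elements $\Delta_{k+1}$\<close>

text \<open>
  Expressions in the generators are written in the free algebra; their values in the quotients
  are obtained by applying the canonical projections.
\<close>

definition kbar :: "nat \<Rightarrow> nat" where
  "kbar k = (if even k then 1 else 0)"

text \<open>\<open>BG i\<close> is $\mathbb{G}_{i+1}$.\<close>

definition BG :: "nat \<Rightarrow> 'k::field free_alg" where
  "BG i = G i + Gt i"

definition BW :: "'k::field \<Rightarrow> nat \<Rightarrow> nat \<Rightarrow> 'k free_alg" where
  "BW q i j = sc (q - inverse q) * (Wm i * Wp j + Wp i * Wm j)"

definition BF :: "'k::field \<Rightarrow> 'k \<Rightarrow> nat \<Rightarrow> nat \<Rightarrow> 'k free_alg" where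
  "BF q \<rho> i j = sc (q - inverse q) *
     (sc (q\<^sup>2 + inverse q ^ 2) * (Wm i * Wm j + Wp i * Wp j)
      + sc (1 / \<rho>) * (G j * Gt i + Gt j * G i))"

text \<open>\<open>c_coef q k\<close> is $c_{k+1}$.\<close>

definition c_coef :: "'k::field \<Rightarrow> nat \<Rightarrow> 'k" where
  "c_coef q k =
     - ((q + inverse q) ^ (k + 1) * (q ^ (k + 1) + inverse q ^ (k + 1)) / q ^ (2 * k + 2))"

text \<open>
  The quotient of factorials is an integer, formed before passing to the field, whose
  characteristic may be positive.
\<close>

definition w_coef :: "'k::field \<Rightarrow> nat \<Rightarrow> int \<Rightarrow> 'k" where
  "w_coef q i m = (if m < 0 then 0 else
     (- 1) ^ nat m * of_nat (fact (nat m + i) div (fact (nat m) * fact i))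
       * (q + inverse q) ^ (i + 1) * q powi (- int i - 2 * m - 1))"

text \<open>
  In \<open>e_coef\<close> and \<open>f_coef\<close> the division by 2 is exact for all $i, j$ that occur in
  $\Delta_{k+1}$.  The summation bounds are integers, so that a negative upper bound gives
  the empty sum.
\<close>

definition e_coef :: "'k::field \<Rightarrow> nat \<Rightarrow> nat \<Rightarrow> nat \<Rightarrow> 'k" where
  "e_coef q k i j = (let N = int (k div 2) - (int i + int j + int (kbar k)) div 2 in
     - (inverse (c_coef q k)
        * (\<Sum>m\<in>{0..N}. w_coef q i (N - m) * w_coef q j m * q powi (- 2 * int j - 4 * m - 2))))"

definition f_coef :: "'k::field \<Rightarrow> nat \<Rightarrow> nat \<Rightarrow> nat \<Rightarrow> 'k" where
  "f_coef q k i j = (let N = int (k div 2) - (int i + int j + int (kbar k) - 1) div 2 in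
     inverse (c_coef q k)
     * (\<Sum>m\<in>{0..N}. w_coef q i (N - m) * (w_coef q j m + w_coef q j (m - 1))
                      * q powi (- 2 * int j - 4 * m)))"

definition d_coef :: "'k::field \<Rightarrow> nat \<Rightarrow> nat \<Rightarrow> 'k" where
  "d_coef q k l = - (inverse (c_coef q k)
     * w_coef q (2 * l + 1 - kbar k) (int (k div 2) - int l) * (1 + q powi (- 2 * int k - 2)))"

text \<open>
  \<open>Delta q \<rho> k\<close> is $\Delta_{k+1}$; the argument \<open>2 * l + 1 - kbar k\<close> of \<open>BG\<close> is the index
  $2(l+1) - \bar k$ shifted by one.
\<close>

definition Delta :: "'k::field \<Rightarrow> 'k \<Rightarrow> nat \<Rightarrow> 'k free_alg" where
  "Delta q \<rho> k =
     BG k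
     + (\<Sum>l\<in>{l. l < k div 2}. sc (d_coef q k l) * BG (2 * l + 1 - kbar k))
     + (\<Sum>l\<in>{l. l \<le> k div 2}. \<Sum>(i, j)\<in>{(i, j). i + j = 2 * l + 1 - kbar k}.
          sc (f_coef q k i j) * BW q i j)
     + (\<Sum>l\<in>{l. l + kbar k \<le> k div 2}. \<Sum>(i, j)\<in>{(i, j). i + j = 2 * l + kbar k}.
          sc (e_coef q k i j) * BF q \<rho> i j)"


section \<open>The quotient and the automorphism $\Omega$\<close>

text \<open>The scalar $\delta_{k+1}$ is \<open>\<delta> (k + 1)\<close>; the value \<open>\<delta> 0\<close> is not used.\<close>

definition tA_ideal :: "'k::field \<Rightarrow> 'k \<Rightarrow> (nat \<Rightarrow> 'k) \<Rightarrow> 'k free_alg set set" where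
  "tA_ideal q \<rho> \<delta> =
     Idl\<^bsub>Aq q \<rho>\<^esub> {toAq q \<rho> (Delta q \<rho> k) \<ominus>\<^bsub>Aq q \<rho>\<^esub> toAq q \<rho> (sc (2 * \<delta> (k + 1))) | k. True}"

definition tA :: "'k::field \<Rightarrow> 'k \<Rightarrow> (nat \<Rightarrow> 'k) \<Rightarrow> 'k free_alg set set ring" where
  "tA q \<rho> \<delta> = Aq q \<rho> Quot (tA_ideal q \<rho> \<delta>)"

definition toA :: "'k::field \<Rightarrow> 'k \<Rightarrow> (nat \<Rightarrow> 'k) \<Rightarrow> 'k free_alg \<Rightarrow> 'k free_alg set set" where
  "toA q \<rho> \<delta> x = tA_ideal q \<rho> \<delta> +>\<^bsub>Aq q \<rho>\<^esub> toAq q \<rho> x"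

fun swap_gen :: "gen \<Rightarrow> gen" where
  "swap_gen (GWm k) = GWp k"
| "swap_gen (GWp k) = GWm k"
| "swap_gen (GG k) = GGt k"
| "swap_gen (GGt k) = GG k"

definition swap_word :: "word \<Rightarrow> word" where
  "swap_word w = Word (map swap_gen (letters w))"

text \<open>
  \<open>map_key f p\<close> is the composite of \<open>p\<close> with the injection \<open>f\<close>.  As \<open>swap_word\<close> is an
  involution, this is the algebra endomorphism that exchanges the generators.  The maps on
  the two quotients are induced by it: they act on cosets by taking images.
\<close>

definition Omega_free :: "'k::field free_alg \<Rightarrow> 'k free_alg" where
  "Omega_free p = Poly_Mapping.map_key swap_word p"

definition Omega_Aq :: "'k::field free_alg set \<Rightarrow> 'k free_alg set" where
  "Omega_Aq C = Omega_free ` C"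

definition Omega :: "'k::field free_alg set set \<Rightarrow> 'k free_alg set set" where
  "Omega C = Omega_Aq ` C"

end

theory Submission
  imports Defs
begin

text \<open>
  The only term of positive degree in $V$ in relations (3) and (6) is the factor $V$, so their
  coefficients of $V^0$ involve a single generator in $v$, namely $W_0$.  In (3) this gives
  $G_{k+1} - \tilde G_{k+1} = (q + q^{-1}) [W_{k+1}, W_0]$, while $\Delta_{k+1} = 2 \delta_{k+1}$
  gives $G_{k+1} + \tilde G_{k+1}$; half the sum is the first formula.  In (6) it gives the second
  formula.  Exchanging the generators interchanges the two choices of sign in the relations and
  fixes $\Delta_{k+1}$ already in the free algebra, hence $\Omega$ is an automorphism of both
  quotients.
\<close>

section \<open>Isomorphisms of quotient rings\<close>

lemma ring_iso_genideal:
  assumes "ring R" "ring S" and h: "h \<in> ring_iso R S" and H: "H \<subseteq> carrier R"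
  shows "h ` (Idl\<^bsub>R\<^esub> H) = Idl\<^bsub>S\<^esub> (h ` H)"
proof -
  \<comment> \<open>Stated for arbitrary rings, because it serves once for \<open>h\<close> and
    once, with the rings exchanged, for the inverse \<open>g\<close>.\<close>
  have sub: "h ` (Idl\<^bsub>R\<^esub> H) \<subseteq> Idl\<^bsub>S\<^esub> (h ` H)"
    if "ring R" "ring S" "h \<in> ring_iso R S" "H \<subseteq> carrier R"
    for R :: "('x, 'm) ring_scheme" and S :: "('y, 'n) ring_scheme" and h H
  proof -
    interpret R: ring R by fact
    interpret S: ring S by fact
    interpret ring_hom_ring R S h
      using that by unfold_locales (auto simp: ring_iso_def)
    have sub: "h ` H \<subseteq> carrier S"
      using that(4) by auto
    have "ideal {r \<in> carrier R. h r \<in> Idl\<^bsub>S\<^esub> (h ` H)} R"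
      by (intro ideal_vimage S.genideal_ideal sub)
    moreover have "H \<subseteq> {r \<in> carrier R. h r \<in> Idl\<^bsub>S\<^esub> (h ` H)}"
      using S.genideal_self[OF sub] that(4) by auto
    ultimately show ?thesis
      using R.genideal_minimal by blast
  qed
  define g where "g = inv_into (carrier R) h"
  have g: "g \<in> ring_iso S R"
    unfolding g_def by (rule ring_iso_set_sym[OF \<open>ring R\<close> h])
  have bij: "bij_betw h (carrier R) (carrier S)"
    using ring_iso_memE(5)[OF h] .
  have hH: "h ` H \<subseteq> carrier S"
    using bij H by (auto simp: bij_betw_def)
  have gh: "g ` h ` H = H"
    unfolding g_def using bij H by (simp add: bij_betw_def)
  have *: "g ` (Idl\<^bsub>S\<^esub> (h ` H)) \<subseteq> Idl\<^bsub>R\<^esub> H"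
    using sub[OF assms(2,1) g hH] gh by simp
  have "Idl\<^bsub>S\<^esub> (h ` H) \<subseteq> h ` (Idl\<^bsub>R\<^esub> H)"
  proof
    fix y assume y: "y \<in> Idl\<^bsub>S\<^esub> (h ` H)"
    have "y \<in> carrier S"
      using y ring.genideal_ideal[OF \<open>ring S\<close> hH] by (auto dest: ideal.Icarr)
    hence "h (g y) = y"
      unfolding g_def using bij by (auto simp: bij_betw_def f_inv_into_f)
    with * y show "y \<in> h ` (Idl\<^bsub>R\<^esub> H)"
      by (metis image_eqI image_subset_iff)
  qed
  with sub[OF assms] show ?thesis by blast
qed

lemma image_coset_ring_iso_Quot:
  assumes I: "ideal I R" and J: "ideal J S" and h: "h \<in> ring_iso R S" and hI: "h ` I = J"
  shows "(`) h \<in> ring_iso (R Quot I) (S Quot J)"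
proof -
  interpret I: ideal I R by fact
  interpret J: ideal J S by fact
  note hh = ring_iso_memE[OF h]
  have carr: "carrier (R Quot I) = (\<lambda>x. I +>\<^bsub>R\<^esub> x) ` carrier R"
    "carrier (S Quot J) = (\<lambda>x. J +>\<^bsub>S\<^esub> x) ` carrier S"
    by (auto simp: FactRing_def A_RCOSETS_def')
  have coset: "h ` (I +>\<^bsub>R\<^esub> x) = J +>\<^bsub>S\<^esub> h x" if "x \<in> carrier R" for x
    using a_coset_hom(2)[of h R S I x] h that I.a_subset hI by (simp add: ring_iso_def)
  have surj: "h ` carrier R = carrier S" and inj: "inj_on h (carrier R)"
    using hh(5) by (auto simp: bij_betw_def)
  have hom: "(`) h \<in> ring_hom (R Quot I) (S Quot J)"
  proof (intro ring_hom_memI)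
    fix A B assume "A \<in> carrier (R Quot I)" "B \<in> carrier (R Quot I)"
    then obtain x y where xy: "x \<in> carrier R" "A = I +>\<^bsub>R\<^esub> x" "y \<in> carrier R" "B = I +>\<^bsub>R\<^esub> y"
      by (auto simp: carr)
    show "h ` (A \<otimes>\<^bsub>R Quot I\<^esub> B) = h ` A \<otimes>\<^bsub>S Quot J\<^esub> h ` B"
      using xy by (simp add: FactRing_def I.rcoset_mult_add J.rcoset_mult_add coset hh)
    show "h ` (A \<oplus>\<^bsub>R Quot I\<^esub> B) = h ` A \<oplus>\<^bsub>S Quot J\<^esub> h ` B"
      using xy by (simp add: FactRing_def I.a_rcos_sum J.a_rcos_sum coset hh)
  next
    fix A assume "A \<in> carrier (R Quot I)"
    then show "h ` A \<in> carrier (S Quot J)"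
      unfolding carr by (auto simp: coset hh)
  qed (simp add: coset hh FactRing_def)
  moreover have "(`) h ` carrier (R Quot I) = carrier (S Quot J)"
  proof -
    have "(`) h ` carrier (R Quot I) = (\<lambda>x. J +>\<^bsub>S\<^esub> h x) ` carrier R"
      unfolding carr image_image by (rule image_cong) (simp_all add: coset)
    also have "\<dots> = (\<lambda>x. J +>\<^bsub>S\<^esub> x) ` h ` carrier R"
      by (simp only: image_image)
    finally show ?thesis
      by (simp only: surj carr)
  qed
  \<comment> \<open>A coset lies in the carrier, where \<open>h\<close> is injective, so its image
    determines it.\<close>
  moreover have "inj_on ((`) h) (carrier (R Quot I))"
  proof (rule inj_onI)
    fix A B assume "A \<in> carrier (R Quot I)" "B \<in> carrier (R Quot I)" "h ` A = h ` B"
    moreover have "A \<subseteq> carrier R" if "A \<in> carrier (R Quot I)" for A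
    proof -
      obtain x where "x \<in> carrier R" "A = I +>\<^bsub>R\<^esub> x"
        using \<open>A \<in> carrier (R Quot I)\<close> unfolding carr by blast
      thus ?thesis
        using I.a_r_coset_subset_G[OF I.a_subset] by simp
    qed
    ultimately show "A = B"
      using inj by (meson inj_on_image_eq_iff)
  qed
  ultimately show ?thesis
    by (simp add: ring_iso_def bij_betw_def)
qed

lemma ring_ring_of_type_algebra: "ring (ring_of_type_algebra :: 'a::ring_1 ring)"
proof -
  have "\<exists>y. x + y = 0" for x :: 'a
    using add.right_inverse by blast
  thus ?thesis
    unfolding ring_of_type_algebra_def using add.right_inverse
    by unfold_locales (auto simp: algebra_simps Units_def)
qed


section \<open>Coefficientwise maps of Laurent series\<close>

locale inj_ring_1_hom =
  fixes h :: "'a::ring_1 \<Rightarrow> 'b::ring_1"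
  assumes hom_add: "h (x + y) = h x + h y"
    and hom_mult: "h (x * y) = h x * h y"
    and hom_one [simp]: "h 1 = 1"
    and hom_eq_0_iff [simp]: "h x = 0 \<longleftrightarrow> x = 0"
begin

lemma hom_zero [simp]: "h 0 = 0"
  by simp

lemma hom_uminus: "h (- x) = - h x"
  using hom_add[of "- x" x] by (simp add: eq_neg_iff_add_eq_0)

lemma hom_diff: "h (x - y) = h x - h y"
  using hom_add[of x "- y"] by (simp add: hom_uminus)

lemma hom_sum: "h (\<Sum>i\<in>A. f i) = (\<Sum>i\<in>A. h (f i))"
  by (induction A rule: infinite_finite_induct) (simp_all add: hom_add)

lemma hom_comm: "h (comm x y) = comm (h x) (h y)"
  by (simp add: comm_def hom_diff hom_mult)

end

definition fls_map :: "('a::zero \<Rightarrow> 'b::zero) \<Rightarrow> 'a fls \<Rightarrow> 'b fls" where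
  "fls_map h f = Abs_fls (\<lambda>n. h (fls_nth f n))"

context inj_ring_1_hom
begin

lemma fls_map_nth [simp]: "fls_nth (fls_map h f) n = h (fls_nth f n)"
\<comment> \<open>\<open>Abs_fls\<close> returns the prescribed coefficients only if they vanish
  below some bound; since \<open>h\<close> maps 0 to 0, the bound of \<open>f\<close>
  serves.\<close>
proof -
  have "\<exists>N. \<forall>n<N. h (fls_nth f n) = 0"
    by (metis fls_nth_vanishes_belowE hom_zero)
  thus ?thesis
    unfolding fls_map_def by (rule nth_Abs_fls_ex_lower_bound)
qed

text \<open>Injectivity of \<open>h\<close> enters here: no leading coefficient is killed. The
  convolution formula for products has a summation range given by subdegrees, so multiplicativity of
  \<open>fls_map h\<close> relies on this.\<close>

lemma fls_subdegree_fls_map [simp]: "fls_subdegree (fls_map h f) = fls_subdegree f"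
proof (cases "f = 0")
  case True
  hence "fls_map h f = 0" by (intro fls_eqI) simp
  with True show ?thesis by simp
qed (auto intro: fls_subdegree_eqI)

text \<open>The locale reproduces itself one level up, so two applications reach the nested series
  in U and V.\<close>

lemma inj_ring_1_hom_fls_map: "inj_ring_1_hom (fls_map h)"
proof
  fix f g :: "'a fls"
  show "fls_map h (f + g) = fls_map h f + fls_map h g"
    by (intro fls_eqI) (simp add: hom_add)
  show "fls_map h (f * g) = fls_map h f * fls_map h g"
    by (intro fls_eqI) (simp add: fls_times_nth(1) hom_sum hom_mult)
  show "fls_map h 1 = 1"
    by (intro fls_eqI) simp
  show "fls_map h f = 0 \<longleftrightarrow> f = 0"
    by (simp add: fls_eq_iff)
qed

lemma fls_map_const [simp]: "fls_map h (fls_const c) = fls_const (h c)"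
  by (intro fls_eqI) simp

lemma fls_map_X_inv [simp]: "fls_map h fls_X_inv = fls_X_inv"
  by (intro fls_eqI) simp

end

text \<open>The Laurent variable is the inverse of U or V, so the coefficient of the power -k-1 sits
  at index k+1; index 0 carries nothing.\<close>

lemma gser_nth: "fls_nth (gser a) n = (if n \<ge> 1 then a (nat (n - 1)) else 0)"
  by (simp add: gser_def fls_X_times_conv_shift)

lemma (in inj_ring_1_hom) fls_map_gser: "fls_map h (gser a) = gser (\<lambda>k. h (a k))"
  by (intro fls_eqI) (simp add: gser_nth)


section \<open>The exchange of generators\<close>

lemma swap_gen_swap_gen [simp]: "swap_gen (swap_gen g) = g"
  by (cases g) simp_all

lemma swap_word_swap_word [simp]: "swap_word (swap_word w) = w"
  by (cases w) (simp add: swap_word_def comp_def)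

lemma swap_word_0 [simp]: "swap_word 0 = 0"
  by (simp add: swap_word_def zero_word_def)

lemma swap_word_plus: "swap_word (v + w) = swap_word v + swap_word w"
  by (simp add: swap_word_def plus_word_def)

lemma inj_swap_word: "inj swap_word"
  by (rule inj_on_inverseI[of _ swap_word]) simp

lemma Omega_free_single: "Omega_free (Poly_Mapping.single w c) = Poly_Mapping.single (swap_word w) c"
  \<comment> \<open>\<open>map_key\<close> composes with \<open>swap_word\<close> and so moves a key
    by the inverse map; the instance at \<open>swap_word w\<close> works because the map is an
    involution.\<close>
  using Poly_Mapping.map_key_single[OF inj_swap_word, of "swap_word w" c]
  by (simp add: Omega_free_def)

lemma Omega_free_add: "Omega_free (x + y) = Omega_free x + Omega_free y"
  by (simp add: Omega_free_def Poly_Mapping.map_key_plus[OF inj_swap_word])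

lemma Omega_free_0 [simp]: "Omega_free 0 = 0"
  using Omega_free_add[of 0 0] by simp

lemma Omega_free_Omega_free [simp]: "Omega_free (Omega_free x) = x"
  by (simp add: Omega_free_def Poly_Mapping.map_key_compose[OF inj_swap_word inj_swap_word]
      comp_def Poly_Mapping.map_key_id)

text \<open>Reduces additive identities in the free algebra to monomials.\<close>

lemma poly_mapping_single_add_induct [case_names zero single_add]:
  assumes "P 0" and "\<And>k c f. P f \<Longrightarrow> P (Poly_Mapping.single k c + f)"
  shows "P (f :: 'a \<Rightarrow>\<^sub>0 'b::comm_monoid_add)"
proof (induction f rule: Poly_Mapping.update_induct)
  case const
  show ?case by (rule assms(1))
next
  case (update f a b)
  have "Poly_Mapping.update a b f = Poly_Mapping.single a b + f"
    using update.hyps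
    by (intro poly_mapping_eqI) (auto simp: lookup_update lookup_add lookup_single when_def in_keys_iff)
  with assms(2)[OF update.IH] show ?case by simp
qed

text \<open>Both sides are biadditive, so two monomials suffice; there it is
  \<open>swap_word_plus\<close>, addition of words being concatenation.\<close>

lemma Omega_free_mult: "Omega_free (x * y) = Omega_free x * Omega_free y"
proof (induction x rule: poly_mapping_single_add_induct)
  case (single_add v a x)
  have "Omega_free (Poly_Mapping.single v a * y) = Poly_Mapping.single (swap_word v) a * Omega_free y"
    by (induction y rule: poly_mapping_single_add_induct)
      (simp_all add: distrib_left Omega_free_add mult_single Omega_free_single swap_word_plus)
  with single_add show ?case
    by (simp add: distrib_right Omega_free_add Omega_free_single)
qed simp

interpretation Omega_free: inj_ring_1_hom "Omega_free :: 'k::field free_alg \<Rightarrow> 'k free_alg"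
proof
  show "Omega_free (1 :: 'k free_alg) = 1"
    by (simp add: Omega_free_single flip: single_one)
  show "Omega_free x = 0 \<longleftrightarrow> x = 0" for x :: "'k free_alg"
    by (metis Omega_free_0 Omega_free_Omega_free)
qed (simp_all add: Omega_free_add Omega_free_mult)

lemma Omega_free_sc [simp]: "Omega_free (sc c) = sc c"
  by (simp add: sc_def Omega_free_single)

lemma Omega_free_gen_elem: "Omega_free (gen_elem g) = gen_elem (swap_gen g)"
  by (simp add: gen_elem_def Omega_free_single swap_word_def)

section \<open>Action of the exchange on series, relators and \<open>Delta\<close>\<close>

lemma opp_opp [simp]: "opp (opp s) = s"
  by (cases s) simp_all

lemma Omega_free_Wgen: "Omega_free (Wgen s k) = Wgen (opp s) k"
  by (cases s) (simp_all add: Omega_free_gen_elem)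

lemma Omega_free_Ggen: "Omega_free (Ggen s k) = Ggen (opp s) k"
  by (cases s) (simp_all add: Omega_free_gen_elem)

interpretation Omega_fls: inj_ring_1_hom "fls_map Omega_free :: 'k::field free_alg fls \<Rightarrow> _"
  by (rule Omega_free.inj_ring_1_hom_fls_map)

definition Omega_series :: "'k::field series \<Rightarrow> 'k series" where
  "Omega_series = fls_map (fls_map Omega_free)"

interpretation Omega_series: inj_ring_1_hom "Omega_series :: 'k::field series \<Rightarrow> 'k series"
  unfolding Omega_series_def by (rule Omega_fls.inj_ring_1_hom_fls_map)

lemma Omega_series_generators:
  "Omega_series (cst c) = cst c" "Omega_series U = U" "Omega_series V = V"
  "Omega_series (Wu s) = Wu (opp s)" "Omega_series (Wv s) = Wv (opp s)"
  "Omega_series (Gu s) = Gu (opp s)" "Omega_series (Gv s) = Gv (opp s)"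
  by (simp_all add: Omega_series_def cst_def U_def V_def Wu_def Wv_def Gu_def Gv_def
      Omega_free.fls_map_gser Omega_fls.fls_map_gser Omega_free_Wgen Omega_free_Ggen)

text \<open>The exchange replaces every sign by its opposite. Relations (2) and (9) return with
  their summands permuted, and the two cases of (7) change places.\<close>

lemma Omega_series_relation_series:
  "Omega_series ` relation_series q \<rho> s = relation_series q \<rho> (opp s)"
  by (cases s)
    (simp_all add: relation_series_def Let_def qcomm_ser_def Omega_series.hom_comm
      Omega_series.hom_add Omega_series.hom_diff Omega_series.hom_mult
      Omega_series_generators add.commute insert_commute)

lemma Omega_free_relators: "Omega_free ` relators q \<rho> = relators q \<rho>"
proof -
  have sub: "Omega_free ` relators q \<rho> \<subseteq> relators q \<rho>"
  proof
    fix x assume "x \<in> Omega_free ` relators q \<rho>"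
    then obtain S a b s where "S \<in> relation_series q \<rho> s" "x = Omega_free (fls_nth (fls_nth S b) a)"
      by (auto simp: relators_def)
    moreover from this have "Omega_series S \<in> relation_series q \<rho> (opp s)"
      by (subst Omega_series_relation_series[symmetric]) simp
    ultimately show "x \<in> relators q \<rho>"
      unfolding relators_def Omega_series_def
      by (smt (verit) Omega_fls.fls_map_nth Omega_free.fls_map_nth mem_Collect_eq)
  qed
  \<comment> \<open>As \<open>Omega_free\<close> is an involution, applying it to the inclusion
    yields the reverse one.\<close>
  moreover have "relators q \<rho> = Omega_free ` Omega_free ` relators q \<rho>"
    by (simp add: image_image)
  ultimately show ?thesis by blast
qed

text \<open>\<open>BG\<close>, \<open>BW\<close> and \<open>BF\<close> are built from sums of two
  terms that the exchange swaps, so only commutativity of addition is used.\<close>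

lemma Omega_free_Delta: "Omega_free (Delta q \<rho> k) = Delta q \<rho> k"
proof -
  have BG: "Omega_free (BG i) = (BG i :: 'a free_alg)" for i
    by (simp add: BG_def Omega_free_add Omega_free_gen_elem add.commute)
  have BW: "Omega_free (BW q i j) = BW q i j" for i j
    by (simp add: BW_def Omega_free_add Omega_free_mult Omega_free_gen_elem add.commute)
  have BF: "Omega_free (BF q \<rho> i j) = BF q \<rho> i j" for i j
    by (simp add: BF_def Omega_free_add Omega_free_mult Omega_free_gen_elem add.commute)
  show ?thesis
    by (simp add: Delta_def Omega_free_add Omega_free_mult Omega_free.hom_sum BG BW BF
        case_prod_unfold)
qed


section \<open>The two quotients\<close>

abbreviation free_ring :: "'k::field free_alg ring" where
  "free_ring \<equiv> ring_of_type_algebra"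

lemma free_ring_simps [simp]:
  "carrier (ring_of_type_algebra :: 'a::ring_1 ring) = UNIV"
  "x \<otimes>\<^bsub>ring_of_type_algebra\<^esub> y = x * (y :: 'a)"
  "x \<oplus>\<^bsub>ring_of_type_algebra\<^esub> y = x + (y :: 'a)"
  "\<one>\<^bsub>ring_of_type_algebra\<^esub> = (1 :: 'a)"
  "\<zero>\<^bsub>ring_of_type_algebra\<^esub> = (0 :: 'a)"
  by (simp_all add: ring_of_type_algebra_def)

lemma free_ring_minus [simp]: "x \<ominus>\<^bsub>ring_of_type_algebra\<^esub> y = x - (y :: 'a::ring_1)"
proof -
  interpret ring "ring_of_type_algebra :: 'a ring" by (rule ring_ring_of_type_algebra)
  have "\<ominus>\<^bsub>ring_of_type_algebra\<^esub> y = - y"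
    by (rule minus_equality) auto
  thus ?thesis by (simp add: minus_eq)
qed

lemma ideal_Aq_ideal: "ideal (Aq_ideal q \<rho>) free_ring"
  unfolding Aq_ideal_def by (rule ring.genideal_ideal[OF ring_ring_of_type_algebra]) simp

lemma ring_Aq: "ring (Aq q \<rho>)"
  unfolding Aq_def by (rule ideal.quotient_is_ring[OF ideal_Aq_ideal])

lemma toAq_ring_hom: "toAq q \<rho> \<in> ring_hom free_ring (Aq q \<rho>)"
  unfolding Aq_def toAq_def[abs_def] by (rule ideal.rcos_ring_hom[OF ideal_Aq_ideal])

lemma toAq_closed [simp]: "toAq q \<rho> x \<in> carrier (Aq q \<rho>)"
  using ring_hom_closed[OF toAq_ring_hom] by simp

lemma toAq_diff: "toAq q \<rho> x \<ominus>\<^bsub>Aq q \<rho>\<^esub> toAq q \<rho> y = toAq q \<rho> (x - y)"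
proof -
  interpret ring_hom_ring free_ring "Aq q \<rho>" "toAq q \<rho>"
    using ring_ring_of_type_algebra ring_Aq toAq_ring_hom by (rule ring_hom_ringI2)
  have "toAq q \<rho> (x \<ominus>\<^bsub>free_ring\<^esub> y) = toAq q \<rho> x \<ominus>\<^bsub>Aq q \<rho>\<^esub> toAq q \<rho> y"
    using hom_add[of x "\<ominus>\<^bsub>free_ring\<^esub> y"] hom_a_inv[of y] by (simp add: a_minus_def del: free_ring_minus)
  thus ?thesis by simp
qed

text \<open>Each ideal generator becomes the class of a single free-algebra element, one that
  \<open>Omega_free\<close> fixes.\<close>

lemma tA_ideal_eq:
  "tA_ideal q \<rho> \<delta> = Idl\<^bsub>Aq q \<rho>\<^esub> {toAq q \<rho> (Delta q \<rho> k - sc (2 * \<delta> (k + 1))) | k. True}"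
  by (simp add: tA_ideal_def toAq_diff)

lemma ideal_tA_ideal: "ideal (tA_ideal q \<rho> \<delta>) (Aq q \<rho>)"
  unfolding tA_ideal_eq by (rule ring.genideal_ideal[OF ring_Aq]) auto

lemma toA_ring_hom: "toA q \<rho> \<delta> \<in> ring_hom free_ring (tA q \<rho> \<delta>)"
  using ring_hom_trans[OF toAq_ring_hom ideal.rcos_ring_hom[OF ideal_tA_ideal]]
  by (simp add: toA_def[abs_def] tA_def comp_def)

lemma ring_tA: "ring (tA q \<rho> \<delta>)"
  unfolding tA_def by (rule ideal.quotient_is_ring[OF ideal_tA_ideal])

lemma ring_hom_ring_toA: "ring_hom_ring free_ring (tA q \<rho> \<delta>) (toA q \<rho> \<delta>)"
  using ring_ring_of_type_algebra ring_tA toA_ring_hom by (rule ring_hom_ringI2)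

text \<open>Kernel of the composite projection. It turns equalities between cosets of cosets into
  membership statements about ordinary free-algebra elements.\<close>

definition tA_kernel :: "'k::field \<Rightarrow> 'k \<Rightarrow> (nat \<Rightarrow> 'k) \<Rightarrow> 'k free_alg set" where
  "tA_kernel q \<rho> \<delta> = {x. toA q \<rho> \<delta> x = \<zero>\<^bsub>tA q \<rho> \<delta>\<^esub>}"

lemma toA_eqI:
  assumes "x - y \<in> tA_kernel q \<rho> \<delta>"
  shows "toA q \<rho> \<delta> x = toA q \<rho> \<delta> y"
proof -
  interpret ring_hom_ring free_ring "tA q \<rho> \<delta>" "toA q \<rho> \<delta>" by (rule ring_hom_ring_toA)
  have "toA q \<rho> \<delta> x = toA q \<rho> \<delta> ((x - y) \<oplus>\<^bsub>free_ring\<^esub> y)"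
    by simp
  also have "\<dots> = toA q \<rho> \<delta> (x - y) \<oplus>\<^bsub>tA q \<rho> \<delta>\<^esub> toA q \<rho> \<delta> y"
    by (rule hom_add) simp_all
  also have "\<dots> = toA q \<rho> \<delta> y"
    using assms hom_closed[of y] by (simp add: tA_kernel_def)
  finally show ?thesis .
qed

lemma tA_kernel_add: "x \<in> tA_kernel q \<rho> \<delta> \<Longrightarrow> y \<in> tA_kernel q \<rho> \<delta> \<Longrightarrow> x + y \<in> tA_kernel q \<rho> \<delta>"
  using ring_hom_add[OF toA_ring_hom, of x y q \<rho> \<delta>] ring.ring_simprules(2)[OF ring_tA]
  by (simp add: tA_kernel_def ring.ring_simprules[OF ring_tA])

lemma tA_kernel_mult_left: "y \<in> tA_kernel q \<rho> \<delta> \<Longrightarrow> x * y \<in> tA_kernel q \<rho> \<delta>"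
proof -
  interpret ring_hom_ring free_ring "tA q \<rho> \<delta>" "toA q \<rho> \<delta>" by (rule ring_hom_ring_toA)
  show "y \<in> tA_kernel q \<rho> \<delta> \<Longrightarrow> x * y \<in> tA_kernel q \<rho> \<delta>"
    using hom_mult[of x y] hom_closed[of x] by (simp add: tA_kernel_def)
qed

lemma relators_subset_tA_kernel: "relators q \<rho> \<subseteq> tA_kernel q \<rho> \<delta>"
proof
  fix x assume "x \<in> relators q \<rho>"
  interpret I: ideal "Aq_ideal q \<rho>" free_ring by (rule ideal_Aq_ideal)
  interpret J: ideal "tA_ideal q \<rho> \<delta>" "Aq q \<rho>" by (rule ideal_tA_ideal)
  have "x \<in> Aq_ideal q \<rho>"
    using I.genideal_self[of "relators q \<rho>"] \<open>x \<in> relators q \<rho>\<close> by (auto simp: Aq_ideal_def)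
  \<comment> \<open>The coset of a member of the ideal is the ideal itself, which is the zero of the
    quotient.\<close>
  hence "toAq q \<rho> x = \<zero>\<^bsub>Aq q \<rho>\<^esub>"
    by (simp add: toAq_def Aq_def FactRing_def I.a_rcos_const)
  thus "x \<in> tA_kernel q \<rho> \<delta>"
    by (simp add: tA_kernel_def toA_def tA_def FactRing_def J.a_rcos_const)
qed

lemma Delta_in_tA_kernel: "Delta q \<rho> k - sc (2 * \<delta> (k + 1)) \<in> tA_kernel q \<rho> \<delta>"
proof -
  interpret J: ideal "tA_ideal q \<rho> \<delta>" "Aq q \<rho>" by (rule ideal_tA_ideal)
  have "{toAq q \<rho> (Delta q \<rho> k - sc (2 * \<delta> (k + 1))) | k. True} \<subseteq> tA_ideal q \<rho> \<delta>"
    unfolding tA_ideal_eq by (rule J.genideal_self) auto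
  hence "toAq q \<rho> (Delta q \<rho> k - sc (2 * \<delta> (k + 1))) \<in> tA_ideal q \<rho> \<delta>"
    by blast
  thus ?thesis
    by (simp add: tA_kernel_def toA_def tA_def FactRing_def J.a_rcos_const)
qed

section \<open>Descent of the exchange to both quotients\<close>

lemma Omega_free_ring_iso: "Omega_free \<in> ring_iso free_ring free_ring"
proof (rule ring_iso_memI)
  show "bij_betw Omega_free (carrier free_ring) (carrier free_ring)"
    by (rule bij_betw_byWitness[of _ Omega_free]) auto
qed (simp_all add: Omega_free_add Omega_free_mult)

lemma Omega_free_Aq_ideal: "Omega_free ` Aq_ideal q \<rho> = Aq_ideal q \<rho>"
  unfolding Aq_ideal_def
  using ring_iso_genideal[OF ring_ring_of_type_algebra ring_ring_of_type_algebra
      Omega_free_ring_iso, of "relators q \<rho>"]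
  by (simp add: Omega_free_relators)

lemma Omega_Aq_ring_iso: "Omega_Aq \<in> ring_iso (Aq q \<rho>) (Aq q \<rho>)"
  using image_coset_ring_iso_Quot[OF ideal_Aq_ideal ideal_Aq_ideal Omega_free_ring_iso Omega_free_Aq_ideal]
  by (simp add: Omega_Aq_def[abs_def] Aq_def)

lemma Omega_Aq_toAq: "Omega_Aq (toAq q \<rho> x) = toAq q \<rho> (Omega_free x)"
  using a_coset_hom(2)[of Omega_free free_ring free_ring "Aq_ideal q \<rho>" x] Omega_free_ring_iso
  by (auto simp: Omega_Aq_def toAq_def ring_iso_def Omega_free_Aq_ideal)

text \<open>The generators of this ideal are fixed one by one, since \<open>Delta\<close> and all
  scalars are.\<close>

lemma Omega_Aq_tA_ideal: "Omega_Aq ` tA_ideal q \<rho> \<delta> = tA_ideal q \<rho> \<delta>"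
proof -
  let ?H = "{toAq q \<rho> (Delta q \<rho> k - sc (2 * \<delta> (k + 1))) | k. True}"
  have "Omega_Aq ` ?H = ?H"
  proof -
    have "Omega_Aq (toAq q \<rho> (Delta q \<rho> k - sc c)) = toAq q \<rho> (Delta q \<rho> k - sc c)" for k c
      by (simp add: Omega_Aq_toAq Omega_free.hom_diff Omega_free_Delta)
    thus ?thesis by (force simp: image_iff)
  qed
  moreover have "Omega_Aq ` (Idl\<^bsub>Aq q \<rho>\<^esub> ?H) = Idl\<^bsub>Aq q \<rho>\<^esub> (Omega_Aq ` ?H)"
    by (rule ring_iso_genideal[OF ring_Aq ring_Aq Omega_Aq_ring_iso]) auto
  ultimately show ?thesis
    unfolding tA_ideal_eq by (simp only:)
qed

lemma Omega_ring_iso: "Omega \<in> ring_iso (tA q \<rho> \<delta>) (tA q \<rho> \<delta>)"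
  using image_coset_ring_iso_Quot[OF ideal_tA_ideal ideal_tA_ideal Omega_Aq_ring_iso Omega_Aq_tA_ideal]
  by (simp add: Omega_def[abs_def] tA_def)

text \<open>Reduces the values of \<open>Omega\<close> on classes of generators and scalars to
  renaming letters in the free algebra.\<close>

lemma Omega_toA: "Omega (toA q \<rho> \<delta> x) = toA q \<rho> \<delta> (Omega_free x)"
proof -
  interpret J: ideal "tA_ideal q \<rho> \<delta>" "Aq q \<rho>" by (rule ideal_tA_ideal)
  show ?thesis
    using a_coset_hom(2)[of Omega_Aq "Aq q \<rho>" "Aq q \<rho>" "tA_ideal q \<rho> \<delta>" "toAq q \<rho> x"]
      Omega_Aq_ring_iso[of q \<rho>] J.a_subset
    by (simp add: Omega_def toA_def ring_iso_def Omega_Aq_tA_ideal Omega_Aq_toAq)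
qed


section \<open>Recursive formulas for the generators\<close>

lemma sc_mult: "sc (a * b) = sc a * sc b"
  by (simp add: sc_def mult_single)

lemma sc_add: "sc (a + b) = sc a + sc b"
  by (simp add: sc_def single_add)

lemma sc_1 [simp]: "sc 1 = 1"
  by (simp add: sc_def)

text \<open>Multiplication by U or V lowers the exponent of the Laurent variable, hence the index
  shift. The second equation covers products such as \<open>U * Wu s\<close>, whose second factor is
  constant in V.\<close>

lemma series_nth:
  "fls_nth (fls_nth (U * S) b) a = fls_nth (fls_nth S b) (a + 1)"
  "fls_nth (fls_nth U b * s) a = (if b = 0 then fls_nth s (a + 1) else 0)"
  "fls_nth (fls_nth (V * S) b) a = fls_nth (fls_nth S (b + 1)) a"
  "fls_nth (fls_nth (cst c * S) b) a = sc c * fls_nth (fls_nth S b) a"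
  by (simp_all add: U_def V_def cst_def fls_X_inv_times_conv_shift)

text \<open>The coefficient of $V^0$ in relation (3) with the lower signs.\<close>

lemma W_commutator_relator:
  "- comm (Wp k) (Wm 0) - sc (1 / (q + inverse q)) * (Gt k - G k) \<in> relators q \<rho>"
proof -
  let ?S = "(U - V) * comm (Wu Minus) (Wv Plus)
        - (cst ((q - inverse q) / (\<rho> * (q + inverse q))) * (Gu Minus * Gv Plus - Gv Minus * Gu Plus)
           + cst (1 / (q + inverse q)) * (Gu Minus - Gu Plus + Gv Plus - Gv Minus))"
  have "?S \<in> relation_series q \<rho> Minus"
    by (simp add: relation_series_def Let_def)
  \<comment> \<open>Outer index 0 is the power 0 of V; inner index k+1 is the power -k-1 of
    U.\<close>
  hence "fls_nth (fls_nth ?S 0) (int k + 1) \<in> relators q \<rho>"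
    unfolding relators_def by blast
  \<comment> \<open>Series in v start at the power -1 of V. Hence the quadratic terms in G vanish
    here, and only the part multiplied by V and the terms in u alone survive.\<close>
  also have "fls_nth (fls_nth ?S 0) (int k + 1)
      = - comm (Wp k) (Wm 0) - sc (1 / (q + inverse q)) * (Gt k - G k)"
    by (simp add: left_diff_distrib series_nth comm_def Wu_def Wv_def Gu_def Gv_def gser_nth)
  finally show ?thesis .
qed

text \<open>The coefficient of $V^0$ in relation (6) with the lower signs.\<close>

lemma W_recursion_relator:
  "sc \<rho> * (Wm (k + 1) - Wp k) - qcomm q (Wm 0) (G k) \<in> relators q \<rho>"
proof -
  let ?S = "U * qcomm_ser q (Wu Plus) (Gv Plus) - V * qcomm_ser q (Wv Plus) (Gu Plus)
        - cst (q - inverse q) * (Wu Minus * Gv Plus - Wv Minus * Gu Plus)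
        + cst \<rho> * (U * Wu Plus - V * Wv Plus - Wu Minus + Wv Minus)"
  have "?S \<in> relation_series q \<rho> Minus"
    by (simp add: relation_series_def Let_def)
  hence "fls_nth (fls_nth ?S 0) (int k + 1) \<in> relators q \<rho>"
    unfolding relators_def by blast
  \<comment> \<open>The factor U raises the index in \<open>U * Wu Plus\<close>, producing
    \<open>Wm (k + 1)\<close>. The term \<open>V * Wv Plus\<close> contributes \<open>Wm 0\<close>
    only at inner index 0, which k+1 avoids.\<close>
  also have "fls_nth (fls_nth ?S 0) (int k + 1)
      = sc \<rho> * (Wm (k + 1) - Wp k) - qcomm q (Wm 0) (G k)"
    by (simp add: series_nth qcomm_ser_def qcomm_def mult.assoc Wu_def Wv_def Gu_def Gv_def gser_nth
        nat_add_distrib)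
  finally show ?thesis .
qed

section \<open>The two formulas in the quotient\<close>

lemma toA_Wm_Suc:
  assumes "\<rho> \<noteq> 0"
  shows "toA q \<rho> \<delta> (Wm (k + 1)) = toA q \<rho> \<delta> (sc (1 / \<rho>) * qcomm q (Wm 0) (G k) + Wp k)"
proof (rule toA_eqI)
  have "sc (1 / \<rho>) * (sc \<rho> * (Wm (k + 1) - Wp k) - qcomm q (Wm 0) (G k)) \<in> tA_kernel q \<rho> \<delta>"
    using W_recursion_relator relators_subset_tA_kernel by (intro tA_kernel_mult_left) blast
  also have "sc (1 / \<rho>) * (sc \<rho> * (Wm (k + 1) - Wp k) - qcomm q (Wm 0) (G k))
      = Wm (k + 1) - (sc (1 / \<rho>) * qcomm q (Wm 0) (G k) + Wp k)"
    using assms by (simp add: right_diff_distrib mult.assoc[symmetric] sc_mult[symmetric])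
  finally show "Wm (k + 1) - (sc (1 / \<rho>) * qcomm q (Wm 0) (G k) + Wp k) \<in> tA_kernel q \<rho> \<delta>" .
qed

lemma sum_sc_half: "(\<Sum>i\<in>A. sc (f i / 2) * g i) = sc (1 / 2) * (\<Sum>i\<in>A. sc (f i) * g i)"
  by (simp add: sum_distrib_left mult.assoc[symmetric] sc_mult[symmetric])

lemma toA_G:
  assumes two: "(2 :: 'k::field) \<noteq> 0" and qq: "q + inverse q \<noteq> (0 :: 'k)"
  shows "toA q \<rho> \<delta> (G k) = toA q \<rho> \<delta>
        (- (\<Sum>l\<in>{l. l \<le> k div 2}. \<Sum>(i, j)\<in>{(i, j). i + j = 2 * l + 1 - kbar k}.
              sc (f_coef q k i j / 2) * BW q i j)
         - (\<Sum>l\<in>{l. l + kbar k \<le> k div 2}. \<Sum>(i, j)\<in>{(i, j). i + j = 2 * l + kbar k}.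
              sc (e_coef q k i j / 2) * BF q \<rho> i j)
         - (\<Sum>l\<in>{l. l < k div 2}. sc (d_coef q k l / 2) * BG (2 * l + 1 - kbar k))
         + sc ((q + inverse q) / 2) * comm (Wp k) (Wm 0)
         + sc (\<delta> (k + 1)))" (is "_ = toA q \<rho> \<delta> (- ?F - ?E - ?D + ?C + ?d)")
proof (rule toA_eqI)
  let ?h = "sc (1 / 2 :: 'k)"
  let ?R = "- comm (Wp k) (Wm 0) - sc (1 / (q + inverse q)) * (Gt k - G k)"
  have half: "?h * (x + x) = x" for x
  proof -
    have "?h * (x + x) = (?h + ?h) * x"
      by (simp add: distrib_left distrib_right)
    also have "?h + ?h = 1"
      using two by (simp flip: sc_add)
    finally show ?thesis by simp
  qed
  have C: "sc ((q + inverse q) / 2) * ?R = - ?C - ?h * (Gt k - G k)"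
  proof -
    \<comment> \<open>The multiplier (q + 1/q)/2 is chosen so that the difference
      \<open>Gt k - G k\<close> gets the factor 1/2, matching half of \<open>BG k\<close>.\<close>
    have "c / 2 * (1 / c) = 1 / 2" if "c \<noteq> 0" for c :: 'k
      using that by simp
    note this[OF qq]
    then show ?thesis
      by (simp only: right_diff_distrib mult.assoc[symmetric] sc_mult[symmetric] mult_minus_right)
  qed
  have d: "?h * sc (2 * \<delta> (k + 1)) = ?d"
    using two by (simp add: sc_mult[symmetric])
  have Delta: "?h * Delta q \<rho> k = ?h * BG k + ?D + ?F + ?E"
    by (simp only: Delta_def distrib_left case_prod_unfold sum_sc_half sum_distrib_left[symmetric] sc_1 mult_1_left)
  \<comment> \<open>In this kernel element the two halves of \<open>Gt k\<close> cancel and those of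
    \<open>G k\<close> add up to \<open>G k\<close>.\<close>
  have "?h * (Delta q \<rho> k - sc (2 * \<delta> (k + 1))) + sc ((q + inverse q) / 2) * ?R \<in> tA_kernel q \<rho> \<delta>"
    using W_commutator_relator relators_subset_tA_kernel
    by (intro tA_kernel_add tA_kernel_mult_left Delta_in_tA_kernel) blast
  also have "?h * (Delta q \<rho> k - sc (2 * \<delta> (k + 1))) + sc ((q + inverse q) / 2) * ?R
      = ?h * (G k + G k) - (- ?F - ?E - ?D + ?C + ?d)"
    unfolding right_diff_distrib[of ?h] C d Delta by (simp add: BG_def algebra_simps del: sum_negf)
  finally show "G k - (- ?F - ?E - ?D + ?C + ?d) \<in> tA_kernel q \<rho> \<delta>"
    unfolding half .
qed

text \<open>Otherwise the characteristic divides the prime 2, and in a field it cannot be 1.\<close>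

lemma two_neq_0_if_CHAR_neq_2:
  assumes "CHAR('k::field) \<noteq> 2"
  shows "(2 :: 'k) \<noteq> 0"
proof
  assume "(2 :: 'k) = 0"
  hence "of_nat 2 = (0 :: 'k)" by simp
  hence "CHAR('k) dvd 2"
    by (simp only: of_nat_eq_0_iff_char_dvd)
  hence "CHAR('k) = 1 \<or> CHAR('k) = 2"
    by (meson prime_nat_iff two_is_prime_nat)
  with assms show False by simp
qed

theorem proposition3p1:
  fixes q \<rho> :: "'k::field" and \<delta> :: "nat \<Rightarrow> 'k"
  assumes "CHAR('k) \<noteq> 2"
    and "q \<noteq> 0" and "\<forall>n>0. q ^ n \<noteq> 1"
    and "\<rho> \<noteq> 0"
  shows
    "(\<forall>k. toA q \<rho> \<delta> (G k) = toA q \<rho> \<delta>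
        (- (\<Sum>l\<in>{l. l \<le> k div 2}. \<Sum>(i, j)\<in>{(i, j). i + j = 2 * l + 1 - kbar k}.
              sc (f_coef q k i j / 2) * BW q i j)
         - (\<Sum>l\<in>{l. l + kbar k \<le> k div 2}. \<Sum>(i, j)\<in>{(i, j). i + j = 2 * l + kbar k}.
              sc (e_coef q k i j / 2) * BF q \<rho> i j)
         - (\<Sum>l\<in>{l. l < k div 2}. sc (d_coef q k l / 2) * BG (2 * l + 1 - kbar k))
         + sc ((q + inverse q) / 2) * comm (Wp k) (Wm 0)
         + sc (\<delta> (k + 1))))
     \<and> (\<forall>k. toA q \<rho> \<delta> (Wm (k + 1)) =
              toA q \<rho> \<delta> (sc (1 / \<rho>) * qcomm q (Wm 0) (G k) + Wp k))
     \<and> Omega \<in> ring_iso (tA q \<rho> \<delta>) (tA q \<rho> \<delta>)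
     \<and> (\<forall>c. Omega (toA q \<rho> \<delta> (sc c)) = toA q \<rho> \<delta> (sc c))
     \<and> (\<forall>k. toA q \<rho> \<delta> (Wp k) = Omega (toA q \<rho> \<delta> (Wm k)))
     \<and> (\<forall>k. toA q \<rho> \<delta> (Gt k) = Omega (toA q \<rho> \<delta> (G k)))"
proof -
  have two: "(2 :: 'k) \<noteq> 0"
    using assms(1) by (rule two_neq_0_if_CHAR_neq_2)
  have "q + inverse q \<noteq> 0"
  proof
    assume "q + inverse q = 0"
    \<comment> \<open>A zero of q + 1/q would be a fourth root of unity.\<close>
    hence "q * q = - 1"
      using assms(2) by (simp add: field_simps eq_neg_iff_add_eq_0)
    hence "q ^ 4 = 1"
      by (simp add: eval_nat_numeral mult.assoc[symmetric])
    with assms(3) show False by simp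
  qed
  with two assms(4) show ?thesis
    by (intro conjI allI)
      (rule toA_G toA_Wm_Suc Omega_ring_iso | simp add: Omega_toA Omega_free_gen_elem)+
qed

end
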